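(* Let $d\ge 1$, let $R$ be a $d\times d$ expansive integer matrix, let $B\subset\mathbb{Z}^d$ be a finite set with $0\in B$ and $\#B\ge 2$, and let $(p_b)_{b\in B}$ be probabilities, i.e. $0<p_b<1$ for all $b\in B$ and $\sum_{b\in B}p_b=1$. Let $\mu=\mu_{B,p}$ be the invariant measure associated to the iterated function system $$\tau_b(x)=R^{-1}(x+b),\qquad (x\in\mathbb{R}^d,\ b\in B)$$ and the probabilities $(p_b)_{b\in B}$. Then there exists an infinite set $\Lambda\subset\mathbb{R}^d$ which is a Riesz basic spectrum for $\mu$ and whose upper Beurling dimension satisfies $\dim^+(\Lambda)>0$.
   Context: A matrix is expansive if all its (complex) eigenvalues have absolute value strictly greater than $1$. Invariant measure: $\mu=\mu_{B,p}$ is the unique Borel probability measure on $\mathbb{R}^d$ such that $\mu(E)=\sum_{b\in B}p_b\,\mu(\tau_b^{-1}(E))$ for all Borel sets $E\subset\mathbb{R}^d$ (equivalently $\int f\,d\mu=\sum_{b\in B}p_b\int f\circ\tau_b\,d\mu$ for all continuous $f$). Its existence and uniqueness are a theorem of Hutchinson. For $\lambda\in\mathbb{R}^d$, $e_\lambda(x):=e^{2\pi i\lambda\cdot x}$. A countable set $\Lambda\subset\mathbb{R}^d$ is a Riesz basic spectrum for $\mu$ if the family $(e_\lambda)_{\lambda\in\Lambda}$ is a Riesz basic sequence in $L^2(\mu)$, i.e. there are constants $C,D>0$ such that for every finitely supported family of complex numbers $(c_\lambda)_{\lambda\in\Lambda}$, $$C\Big(\sum_{\lambda}|c_\lambda|^2\Big)^{1/2}\le\Big\|\sum_{\lambda}c_\lambda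 e_\lambda\Big\|_{L^2(\mu)}\le D\Big(\sum_{\lambda}|c_\lambda|^2\Big)^{1/2}.$$ Beurling dimension: for a discrete set $\Lambda\subset\mathbb{R}^d$ and $r>0$, the upper Beurling density corresponding to $r$ is $$\mathcal{D}_r^+(\Lambda):=\limsup_{h\to\infty}\ \sup_{x\in\mathbb{R}^d}\frac{\#(\Lambda\cap(x+h[-1,1]^d))}{h^r},$$ and the (upper) Beurling dimension is $$\dim^+(\Lambda):=\sup\{r>0:\mathcal{D}_r^+(\Lambda)>0\}=\inf\{r>0:\mathcal{D}_r^+(\Lambda)<\infty\}.$$ *)

theory Defs
  imports "HOL-Probability.Probability"
begin

definition integer_vector :: "real ^ 'n \<Rightarrow> bool" where
  "integer_vector x \<longleftrightarrow> (\<forall>i. x $ i \<in> \<int>)"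

definition integer_matrix :: "real ^ 'n ^ 'm \<Rightarrow> bool" where
  "integer_matrix A \<longleftrightarrow> (\<forall>i j. A $ i $ j \<in> \<int>)"

definition complex_eigenvalue :: "real ^ 'n ^ 'n \<Rightarrow> complex \<Rightarrow> bool" where
  "complex_eigenvalue A z \<longleftrightarrow>
     (\<exists>v :: complex ^ 'n. v \<noteq> 0 \<and> (\<chi> i j. complex_of_real (A $ i $ j)) *v v = z *s v)"

definition expansive :: "real ^ 'n ^ 'n \<Rightarrow> bool" where
  "expansive A \<longleftrightarrow> (\<forall>z. complex_eigenvalue A z \<longrightarrow> 1 < cmod z)"

text \<open>
  An expansive matrix does not have the eigenvalue 0, so that \<open>matrix_inv\<close> is a genuine inverse.
\<close>

definition ifs_map :: "real ^ 'n ^ 'n \<Rightarrow> real ^ 'n \<Rightarrow> real ^ 'n \<Rightarrow> real ^ 'n" where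
  "ifs_map R b x = matrix_inv R *v (x + b)"

text \<open>
  By Hutchinson's theorem, for expansive \<open>R\<close>, finite \<open>B\<close> and probabilities \<open>p\<close> on \<open>B\<close> exactly one
  measure satisfies the following predicate.
\<close>

definition invariant_measure ::
  "real ^ 'n ^ 'n \<Rightarrow> (real ^ 'n) set \<Rightarrow> (real ^ 'n \<Rightarrow> real) \<Rightarrow> (real ^ 'n) measure \<Rightarrow> bool" where
  "invariant_measure R B p \<mu> \<longleftrightarrow>
     prob_space \<mu> \<and> sets \<mu> = sets borel \<and>
     (\<forall>E \<in> sets borel. measure \<mu> E = (\<Sum>b\<in>B. p b * measure \<mu> (ifs_map R b -` E)))"

definition expo :: "real ^ 'n \<Rightarrow> real ^ 'n \<Rightarrow> complex" where
  "expo l x = exp (2 * of_real pi * \<i> * of_real (l \<bullet> x))"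

definition L2_norm :: "'a measure \<Rightarrow> ('a \<Rightarrow> complex) \<Rightarrow> real" where
  "L2_norm \<mu> f = sqrt (\<integral>x. (cmod (f x))\<^sup>2 \<partial>\<mu>)"

definition riesz_basic_spectrum :: "(real ^ 'n) measure \<Rightarrow> (real ^ 'n) set \<Rightarrow> bool" where
  "riesz_basic_spectrum \<mu> \<Lambda> \<longleftrightarrow>
     countable \<Lambda> \<and>
     (\<exists>C D :: real. 0 < C \<and> 0 < D \<and>
       (\<forall>F (c :: real ^ 'n \<Rightarrow> complex). finite F \<and> F \<subseteq> \<Lambda> \<longrightarrow>
          C * sqrt (\<Sum>l\<in>F. (cmod (c l))\<^sup>2) \<le> L2_norm \<mu> (\<lambda>x. \<Sum>l\<in>F. c l * expo l x) \<and>
          L2_norm \<mu> (\<lambda>x. \<Sum>l\<in>F. c l * expo l x) \<le> D * sqrt (\<Sum>l\<in>F. (cmod (c l))\<^sup>2)))"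

text \<open>
  The number of points is taken as \<open>emeasure\<close> of the counting measure instead of \<open>card\<close>, so that
  an infinite intersection counts as \<open>\<infinity>\<close> and not as 0. The set intersected with \<open>\<Lambda>\<close> is the cube
  \<open>x + h [-1, 1]\<^sup>d\<close>.
\<close>

definition upper_beurling_density :: "real \<Rightarrow> (real ^ 'n) set \<Rightarrow> ennreal" where
  "upper_beurling_density r \<Lambda> =
     Limsup at_top (\<lambda>h :: real. SUP x :: real ^ 'n.
       emeasure (count_space UNIV) (\<Lambda> \<inter> {y. \<forall>i. \<bar>y $ i - x $ i\<bar> \<le> h}) / ennreal (h powr r))"

text \<open>
  The supremum is taken in \<^typ>\<open>ennreal\<close>, where the supremum of the empty set is 0.
\<close>

definition upper_beurling_dim :: "(real ^ 'n) set \<Rightarrow> ennreal" where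
  "upper_beurling_dim \<Lambda> = (SUP r \<in> {r. 0 < r \<and> 0 < upper_beurling_density r \<Lambda>}. ennreal r)"

end

(*
  The Fourier transform F of mu satisfies F(xi) = m(A xi) F(A xi), where A is the inverse of the
  transpose of R and m is the Z^d-periodic trigonometric polynomial with weights p and frequencies B.
  Since R^(-k) b tends to 0 for a nonzero b in B, some R^(-M) b is not integral, so there is an integer vector u
  such that m(eta) and m(eta + A^M u) never have modulus 1 simultaneously. By periodicity of m, the
  average of |F(t + xi)| over the 2^n sums t of distinct vectors among A^(-Mk) u, k < n, is at most
  rho^n with rho < 1, uniformly in xi. Hence one can choose greedily points lambda_0, lambda_1, ...
  of polynomial growth such that the sum of |F(lambda_n - lambda_i)| over all pairs i < n is at most 1/4.
  The Gram matrix of the exponentials is then close to the identity, and polynomial growth gives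
  positive dimension.
*)
theory Submission
  imports Defs "HOL-Computational_Algebra.Fundamental_Theorem_Algebra"
begin

section \<open>Powers of the inverse of an expansive matrix\<close>

text \<open>This is q(A) v. It is built from the orbit of the single vector v, since the convergence
  argument treats one orbit at a time.\<close>

definition poly_op :: "'a::field poly \<Rightarrow> 'a ^ 'n ^ 'n \<Rightarrow> 'a ^ 'n \<Rightarrow> 'a ^ 'n" where
  "poly_op q A v = (\<Sum>i\<le>degree q. coeff q i *s ((*v) A ^^ i) v)"

lemma poly_op_eq_sum:
  assumes "degree q \<le> n"
  shows "poly_op q A v = (\<Sum>i\<le>n. coeff q i *s ((*v) A ^^ i) v)"
  unfolding poly_op_def
  by (rule sum.mono_neutral_left) (use assms in \<open>auto simp: coeff_eq_0\<close>)

lemma matrix_vector_mult_sum_right: "A *v sum f I = (\<Sum>i\<in>I. A *v f i)" for A :: "'a::field ^ 'n ^ 'm"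
  by (induction I rule: infinite_finite_induct) (auto simp: matrix_vector_right_distrib)

lemma poly_op_pCons: "poly_op (pCons c q) A v = c *s v + A *v poly_op q A v"
proof -
  have "poly_op (pCons c q) A v = (\<Sum>i\<le>Suc (degree q). coeff (pCons c q) i *s ((*v) A ^^ i) v)"
    by (rule poly_op_eq_sum) (rule degree_pCons_le)
  also have "\<dots> = c *s v + A *v poly_op q A v"
    by (subst sum.atMost_Suc_shift)
      (simp add: poly_op_def matrix_vector_mult_sum_right vector_scalar_commute)
  finally show ?thesis .
qed

lemma poly_op_add: "poly_op (q + q') A v = poly_op q A v + poly_op q' A v"
proof -
  let ?n = "max (degree q) (degree q')"
  show ?thesis
    using poly_op_eq_sum[of q ?n A v] poly_op_eq_sum[of q' ?n A v] 
      poly_op_eq_sum[OF degree_add_le_max, of q q' A v]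
    by (simp add: sum.distrib vec.scale_left_distrib)
qed

lemma poly_op_smult: "poly_op (smult c q) A v = c *s poly_op q A v"
  using poly_op_eq_sum[OF degree_smult_le, of c q A v]
  by (simp add: poly_op_def vec.scale_sum_right)

lemma poly_op_linear_factor:
  "poly_op ([:-z, 1:] * q) A v = A *v poly_op q A v - z *s poly_op q A v"
proof -
  have "[:-z, 1:] * q = smult (-z) q + pCons 0 q" by simp
  then show ?thesis
    by (simp only: poly_op_add poly_op_smult poly_op_pCons) (simp add: vec.scale_minus_left)
qed

text \<open>Since q(A) commutes with A, the linear factor may act on v first. This lets an induction
  on the degree pass from v to A v - z v.\<close>

lemma poly_op_linear_factor':
  "poly_op ([:-z, 1:] * q) A v = poly_op q A (A *v v - z *s v)"
proof -
  have "A *v poly_op q A v = poly_op q A (A *v v)"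
    unfolding poly_op_def
    by (simp add: matrix_vector_mult_sum_right vector_scalar_commute funpow_swap1)
  moreover have "((*v) A ^^ i) (A *v v - z *s v) = ((*v) A ^^ i) (A *v v) - z *s ((*v) A ^^ i) v" for i
    by (induction i) (auto simp: matrix_vector_mult_diff_distrib vector_scalar_commute)
  ultimately show ?thesis
    unfolding poly_op_linear_factor
    by (simp add: poly_op_def vec.scale_right_diff_distrib sum_subtractf vec.scale_sum_right mult.commute)
qed

text \<open>The vectors v, A v, ..., A^d v with d = \<open>CARD('n)\<close> are one too many to be
  independent; the coefficients of a linear relation form the polynomial.\<close>

lemma annihilating_poly_exists:
  fixes A :: "'a::field ^ 'n ^ 'n"
  shows "\<exists>q. q \<noteq> 0 \<and> poly_op q A v = 0"
proof (cases "inj_on (\<lambda>i. ((*v) A ^^ i) v) {..CARD('n)}")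
  case True
  let ?x = "\<lambda>i. ((*v) A ^^ i) v"
  have "card (?x ` {..CARD('n)}) = Suc CARD('n)"
    using True by (simp add: card_image)
  then have "vec.dependent (?x ` {..CARD('n)})"
    by (intro vec.dependent_biggerset_general)
      (simp add: le_imp_less_Suc vec.dim_subset_UNIV[unfolded vec.dimension_def card_cart_basis])
  then obtain u where u: "\<exists>y\<in>?x ` {..CARD('n)}. u y \<noteq> 0" "(\<Sum>y\<in>?x ` {..CARD('n)}. u y *s y) = 0"
    by (subst (asm) vec.dependent_finite) auto
  define q where "q = (\<Sum>i\<le>CARD('n). monom (u (?x i)) i)"
  have cq: "coeff q i = u (?x i)" if "i \<le> CARD('n)" for i
    using that by (simp add: q_def coeff_sum)
  have "degree q \<le> CARD('n)"
    unfolding q_def by (intro degree_sum_le) (auto intro: order.trans[OF degree_monom_le])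
  then have "poly_op q A v = (\<Sum>i\<le>CARD('n). u (?x i) *s ?x i)"
    by (simp add: poly_op_eq_sum cq)
  also have "\<dots> = (\<Sum>y\<in>?x ` {..CARD('n)}. u y *s y)"
    using True by (simp add: sum.reindex)
  finally have "poly_op q A v = 0" using u by simp
  moreover have "q \<noteq> 0"
    using u(1) cq by force
  ultimately show ?thesis by blast
next
  \<comment> \<open>Dependence is a property of the set of iterates and does not see repetitions. A
    repeated iterate is annihilated directly by X^i - X^j.\<close>
  case False
  then obtain i j where ij: "i \<noteq> j" "((*v) A ^^ i) v = ((*v) A ^^ j) v"
    by (auto simp: inj_on_def)
  have mon: "poly_op (monom c k) A v = c *s ((*v) A ^^ k) v" for c k
  proof -
    have "poly_op (monom c k) A v = (\<Sum>l\<le>k. coeff (monom c k) l *s ((*v) A ^^ l) v)"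
      by (rule poly_op_eq_sum) (rule degree_monom_le)
    also have "\<dots> = (\<Sum>l\<le>k. if l = k then c *s ((*v) A ^^ l) v else 0)"
      by (rule sum.cong) auto
    finally show ?thesis by simp
  qed
  let ?q = "monom 1 i + monom (-1) j :: 'a poly"
  have "poly_op ?q A v = 0"
    using ij(2) by (simp add: poly_op_add mon)
  moreover have "coeff ?q i \<noteq> 0" using ij(1) by simp
  then have "?q \<noteq> 0" by (metis coeff_0)
  ultimately show ?thesis by blast
qed

text \<open>The contraction forgets the initial value geometrically, and small errors only add a
  small fixed point.\<close>

lemma affine_recurrence_tendsto_zero:
  fixes x e :: "nat \<Rightarrow> 'a::real_normed_vector"
  assumes rec: "\<And>k. norm (x (Suc k)) \<le> c * norm (x k) + norm (e k)"
    and c: "0 \<le> c" "c < 1" and e: "e \<longlonglongrightarrow> 0"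
  shows "x \<longlonglongrightarrow> 0"
proof (rule LIMSEQ_I)
  fix r :: real assume r: "0 < r"
  \<comment> \<open>Chosen so that r / 2 is the fixed point of the map sending y to c * y +
    \<open>?d\<close>.\<close>
  let ?d = "(1 - c) * r / 2"
  have "0 < ?d" using r c by simp
  with e obtain N where N: "\<And>k. k \<ge> N \<Longrightarrow> norm (e k) < ?d"
    by (metis LIMSEQ_D diff_zero)
  have bd: "norm (x (N + k)) \<le> c ^ k * norm (x N) + r / 2" for k
  proof (induction k)
    case (Suc k)
    have "norm (x (N + Suc k)) \<le> c * norm (x (N + k)) + ?d"
      using rec[of "N + k"] N[of "N + k"] by simp
    also have "\<dots> \<le> c * (c ^ k * norm (x N) + r / 2) + ?d"
      using Suc c by (intro add_mono mult_left_mono) auto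
    finally show ?case by (simp add: field_simps)
  qed (use r in simp)
  have "(\<lambda>k. c ^ k * norm (x N)) \<longlonglongrightarrow> 0"
    using c by (intro tendsto_mult_left_zero LIMSEQ_power_zero) simp
  then obtain K where K: "\<And>k. k \<ge> K \<Longrightarrow> \<bar>c ^ k * norm (x N)\<bar> < r / 2"
    using r by (metis LIMSEQ_D diff_zero half_gt_zero real_norm_def)
  have "norm (x n - 0) < r" if "n \<ge> N + K" for n
  proof -
    have "K \<le> n - N" "N + (n - N) = n" using that by auto
    with bd[of "n - N"] K[of "n - N"] show ?thesis by (auto simp: abs_less_iff)
  qed
  then show "\<exists>no. \<forall>n\<ge>no. norm (x n - 0) < r" by blast
qed

lemma norm_vector_scalar_complex: "norm (z *s v) = cmod z * norm v" for v :: "complex ^ 'n"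
  by (simp add: norm_vec_def L2_set_def norm_mult power_mult_distrib sum_distrib_left[symmetric] real_sqrt_mult)

text \<open>Induction on the degree: if z is a root of q, the quotient by the linear factor
  annihilates w = A v - z v, so the orbit of w tends to 0. The orbit of v satisfies A^(k+1) v = z
  A^k v + A^k w, a recurrence contracting by |z| < 1.\<close>

lemma tendsto_zero_of_poly_op:
  fixes A :: "complex ^ 'n ^ 'n"
  assumes "q \<noteq> 0" "\<And>z. poly q z = 0 \<Longrightarrow> cmod z < 1" "poly_op q A v = 0"
  shows "(\<lambda>k. ((*v) A ^^ k) v) \<longlonglongrightarrow> 0"
  using assms
proof (induction "degree q" arbitrary: q v)
  case 0
  then obtain c where "q = [:c:]" "c \<noteq> 0" by (metis degree_0_id of_nat_0 pCons_0_0 degree_eq_zeroE)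
  with 0 have "v = 0" by (simp add: poly_op_def)
  then have "((*v) A ^^ k) v = 0" for k by (induction k) auto
  then show ?case by simp
next
  case (Suc n)
  from Suc(2) have "\<not> constant (poly q)" by (simp add: constant_degree)
  then obtain z where z: "poly q z = 0" using fundamental_theorem_of_algebra by blast
  then obtain q' where q': "q = [:-z, 1:] * q'" by (auto simp: poly_eq_0_iff_dvd)
  with Suc have "q' \<noteq> 0" by auto
  then have deg: "n = degree q'"
    using Suc(2) by (simp add: q' degree_mult_eq del: mult_pCons_left)
  let ?w = "A *v v - z *s v"
  have lim: "(\<lambda>k. ((*v) A ^^ k) ?w) \<longlonglongrightarrow> 0"
  proof (rule Suc(1)[OF deg \<open>q' \<noteq> 0\<close>])
    show "poly q' y = 0 \<Longrightarrow> cmod y < 1" for y using Suc(4)[of y] by (simp add: q')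
    show "poly_op q' A ?w = 0" using Suc(5) by (simp only: q' poly_op_linear_factor')
  qed
  have step: "((*v) A ^^ k) ?w = ((*v) A ^^ Suc k) v - z *s ((*v) A ^^ k) v" for k
    by (induction k) (auto simp: matrix_vector_mult_diff_distrib vector_scalar_commute)
  show ?case
  proof (rule affine_recurrence_tendsto_zero[OF _ _ _ lim])
    fix k
    have "((*v) A ^^ Suc k) v = z *s ((*v) A ^^ k) v + ((*v) A ^^ k) ?w"
      unfolding step by simp
    then show "norm (((*v) A ^^ Suc k) v) \<le> cmod z * norm (((*v) A ^^ k) v) + norm (((*v) A ^^ k) ?w)"
      by (metis norm_triangle_ineq norm_vector_scalar_complex)
  qed (use Suc(4)[OF z] in auto)
qed

text \<open>The roots of an annihilating polynomial of v of least degree are eigenvalues of A: for a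
  root z with quotient q', the vector q'(A) v is nonzero by minimality, and A - z kills it.\<close>

lemma power_tendsto_zero_complex:
  fixes A :: "complex ^ 'n ^ 'n"
  assumes ev: "\<And>z v. v \<noteq> 0 \<Longrightarrow> A *v v = z *s v \<Longrightarrow> cmod z < 1"
  shows "(\<lambda>k. ((*v) A ^^ k) v) \<longlonglongrightarrow> 0"
proof -
  define P where "P q \<longleftrightarrow> q \<noteq> 0 \<and> poly_op q A v = 0" for q
  obtain q where q: "P q" and min: "\<And>q'. P q' \<Longrightarrow> degree q \<le> degree q'"
    using annihilating_poly_exists[of A v] ex_has_least_nat[of P _ degree] unfolding P_def by blast
  have "cmod z < 1" if z: "poly q z = 0" for z
  proof -
    from z obtain q' where q': "q = [:-z, 1:] * q'" by (auto simp: poly_eq_0_iff_dvd)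
    with q have "q' \<noteq> 0" by (auto simp: P_def)
    then have "degree q' < degree q"
      by (simp add: q' degree_mult_eq del: mult_pCons_left)
    with min[of q'] \<open>q' \<noteq> 0\<close> have "poly_op q' A v \<noteq> 0" by (auto simp: P_def)
    moreover have "A *v poly_op q' A v = z *s poly_op q' A v"
      using q poly_op_linear_factor[of z q' A v] by (simp add: P_def q')
    ultimately show ?thesis by (rule ev)
  qed
  with q show ?thesis by (intro tendsto_zero_of_poly_op) (auto simp: P_def)
qed

section \<open>Inverses of expansive matrices\<close>

lemma expansive_invertible:
  fixes R :: "real ^ 'n ^ 'n"
  assumes "expansive R"
  shows "invertible R"
proof -
  let ?C = "\<lambda>v :: real ^ 'n. (\<chi> i. complex_of_real (v $ i))"
  have "v = 0" if "R *v v = 0" for v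
  proof (rule ccontr)
    assume "v \<noteq> 0"
    then have "?C v \<noteq> 0" by (auto simp: vec_eq_iff)
    moreover have "(\<chi> i j. complex_of_real (R $ i $ j)) *v ?C v = 0 *s ?C v"
      using that by (simp add: vec_eq_iff matrix_vector_mult_def flip: of_real_mult of_real_sum)
    ultimately have "complex_eigenvalue R 0" unfolding complex_eigenvalue_def by blast
    with assms show False by (auto simp: expansive_def)
  qed
  then show ?thesis
    by (simp add: invertible_left_inverse matrix_left_invertible_ker)
qed

text \<open>After complexification, an eigenvector of A for z is an eigenvector of R for 1/z, so
  expansiveness of R gives |z| < 1.\<close>

lemma expansive_inverse_power_tendsto_zero:
  fixes R A :: "real ^ 'n ^ 'n"
  assumes exp: "expansive R" and inv: "R ** A = mat 1"
  shows "(\<lambda>k. ((*v) A ^^ k) v) \<longlonglongrightarrow> 0"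
proof -
  let ?C = "\<lambda>v :: real ^ 'n. (\<chi> i. complex_of_real (v $ i)) :: complex ^ 'n"
  let ?M = "\<lambda>A :: real ^ 'n ^ 'n. (\<chi> i j. complex_of_real (A $ i $ j)) :: complex ^ 'n ^ 'n"
  have CM: "?C (A *v v) = ?M A *v ?C v" for v
    by (simp add: vec_eq_iff matrix_vector_mult_def)
  have inv': "?M R *v (?M A *v v) = v" for v
  proof -
    have "?M R ** ?M A = ?M (R ** A)"
      by (simp add: vec_eq_iff matrix_matrix_mult_def)
    also have "\<dots> = mat 1" unfolding inv by (simp add: vec_eq_iff mat_def)
    finally show ?thesis by (simp add: matrix_vector_mul_assoc)
  qed
  have "(\<lambda>k. ((*v) (?M A) ^^ k) (?C v)) \<longlonglongrightarrow> 0"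
  proof (rule power_tendsto_zero_complex)
    fix z and v :: "complex ^ 'n" assume v: "v \<noteq> 0" "?M A *v v = z *s v"
    have v': "z *s (?M R *v v) = v" using inv'[of v] v(2) by (simp add: vector_scalar_commute)
    with v have "z \<noteq> 0" by auto
    have "?M R *v v = inverse z *s (z *s (?M R *v v))"
      using \<open>z \<noteq> 0\<close> by (simp only: vector_smult_assoc) simp
    then have "?M R *v v = inverse z *s v" unfolding v' .
    with v have "complex_eigenvalue R (inverse z)" unfolding complex_eigenvalue_def by blast
    with exp have "1 < cmod (inverse z)" by (auto simp: expansive_def)
    then show "cmod z < 1" using \<open>z \<noteq> 0\<close> by (simp add: norm_inverse one_less_inverse_iff)
  qed
  moreover have "((*v) (?M A) ^^ k) (?C v) = ?C (((*v) A ^^ k) v)" for k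
    by (induction k) (simp_all add: CM)
  ultimately have lim: "(\<lambda>k. ?C (((*v) A ^^ k) v)) \<longlonglongrightarrow> 0" by simp
  show ?thesis
  proof (rule vec_tendstoI)
    fix i
    from tendsto_vec_nth[OF lim, of i] have "(\<lambda>k. complex_of_real (((*v) A ^^ k) v $ i)) \<longlonglongrightarrow> of_real 0" by simp
    then show "(\<lambda>k. ((*v) A ^^ k) v $ i) \<longlonglongrightarrow> 0 $ i" unfolding tendsto_of_real_iff by simp
  qed
qed

text \<open>The iterates tend to 0, so if all were integral, one of norm below 1 would vanish;
  applying R to it repeatedly would give b = 0.\<close>

lemma expansive_inverse_power_not_integer:
  fixes R A :: "real ^ 'n ^ 'n"
  assumes exp: "expansive R" and inv: "R ** A = mat 1" and b: "b \<noteq> 0"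
  shows "\<exists>k. \<not> integer_vector (((*v) A ^^ k) b)"
proof (rule ccontr)
  let ?x = "\<lambda>k. ((*v) A ^^ k) b"
  assume "\<not> ?thesis"
  then have int: "?x k $ i \<in> \<int>" for k i by (auto simp: integer_vector_def)
  from LIMSEQ_D[OF expansive_inverse_power_tendsto_zero[OF exp inv, of b], of 1]
  obtain k where k: "norm (?x k) < 1" by auto
  have "?x k $ i = 0" for i
  proof -
    have "\<bar>?x k $ i\<bar> < 1" using k component_le_norm_cart[of "?x k" i] by simp
    with int[of k i] show ?thesis by (auto elim!: Ints_cases)
  qed
  then have "?x k = 0" by (simp add: vec_eq_iff)
  moreover have "((*v) R ^^ j) (?x j) = b" for j
  proof (induction j)
    case (Suc j)
    have "((*v) R ^^ Suc j) (?x (Suc j)) = ((*v) R ^^ j) (R *v (A *v ?x j))"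
      by (simp add: funpow_swap1)
    then show ?case using Suc by (simp add: matrix_vector_mul_assoc inv)
  qed simp
  moreover have "((*v) R ^^ j) 0 = 0" for j by (induction j) simp_all
  ultimately show False using b by metis
qed

section \<open>Fourier transform of the invariant measure\<close>

lemma ifs_map_measurable [measurable]: "ifs_map R b \<in> borel_measurable borel"
proof -
  have "continuous_on UNIV (\<lambda>x. matrix_inv R *v (x + b))"
    by (intro bounded_linear.continuous_on[OF matrix_vector_mul_bounded_linear] continuous_intros)
  then show ?thesis
    unfolding ifs_map_def[abs_def] by (rule borel_measurable_continuous_onI)
qed

text \<open>The invariance, stated for sets, says that \<open>\<mu>\<close> is the image of the
  product of the weight measure on B with \<open>\<mu>\<close> under (b, x) ->
  \<open>ifs_map R b x\<close>. Change of variables and Fubini carry it to bounded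
  functions.\<close>

lemma invariant_measure_integral:
  fixes f :: "real ^ 'n \<Rightarrow> 'b::{banach, second_countable_topology}"
  assumes inv: "invariant_measure R B p \<mu>" and B: "finite B" and p: "\<And>b. b \<in> B \<Longrightarrow> 0 \<le> p b"
    and f [measurable]: "f \<in> borel_measurable borel" and bd: "\<And>x. norm (f x) \<le> K"
  shows "integral\<^sup>L \<mu> f = (\<Sum>b\<in>B. p b *\<^sub>R (\<integral>x. f (ifs_map R b x) \<partial>\<mu>))"
proof -
  from inv interpret prob_space \<mu> by (simp add: invariant_measure_def)
  from inv have sets_mu [measurable_cong]: "sets \<mu> = sets borel" by (simp add: invariant_measure_def)
  then have space_mu: "space \<mu> = UNIV" by (simp add: sets_eq_imp_space_eq)
  let ?M = "point_measure B (\<lambda>b. ennreal (p b))"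
  let ?T = "\<lambda>(b, x). ifs_map R b x"
  have fin: "finite_measure ?M"
    by (rule finite_measureI) (simp add: emeasure_point_measure_finite B space_point_measure)
  interpret M: finite_measure ?M by (rule fin)
  interpret P: pair_sigma_finite ?M \<mu> ..
  interpret PF: finite_measure "?M \<Otimes>\<^sub>M \<mu>"
    by (rule finite_measure_pair_measure) unfold_locales
  have T [measurable]: "?T \<in> measurable (?M \<Otimes>\<^sub>M \<mu>) borel"
  proof -
    have "?T \<in> measurable (count_space B \<Otimes>\<^sub>M \<mu>) borel"
      by (rule measurable_pair_measure_countable1) (use B in \<open>auto intro: countable_finite\<close>)
    also have "measurable (count_space B \<Otimes>\<^sub>M \<mu>) borel = measurable (?M \<Otimes>\<^sub>M \<mu>) borel"
      by (intro measurable_cong_sets sets_pair_measure_cong) (simp_all add: sets_point_measure)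
    finally show ?thesis .
  qed
  have eq: "\<mu> = distr (?M \<Otimes>\<^sub>M \<mu>) borel ?T"
  proof (rule measure_eqI)
    fix E assume "E \<in> sets \<mu>"
    then have E [measurable]: "E \<in> sets borel" by (simp add: sets_mu)
    have "emeasure (distr (?M \<Otimes>\<^sub>M \<mu>) borel ?T) E
        = emeasure (?M \<Otimes>\<^sub>M \<mu>) (?T -` E \<inter> space (?M \<Otimes>\<^sub>M \<mu>))"
      by (rule emeasure_distr) auto
    also have "\<dots> = (\<integral>\<^sup>+b. emeasure \<mu> (Pair b -` (?T -` E \<inter> space (?M \<Otimes>\<^sub>M \<mu>))) \<partial>?M)"
      by (rule emeasure_pair_measure_alt) measurable
    also have "\<dots> = (\<Sum>b\<in>B. ennreal (p b) * emeasure \<mu> (Pair b -` (?T -` E \<inter> space (?M \<Otimes>\<^sub>M \<mu>))))"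
      using B by (subst nn_integral_point_measure_finite) (auto simp: p mult.commute)
    also have "\<dots> = (\<Sum>b\<in>B. ennreal (p b) * emeasure \<mu> (ifs_map R b -` E))"
      by (intro sum.cong refl arg_cong2[where f="(*)"] arg_cong[where f="emeasure \<mu>"])
        (auto simp: space_pair_measure space_point_measure space_mu)
    also have "\<dots> = ennreal (\<Sum>b\<in>B. p b * measure \<mu> (ifs_map R b -` E))"
      by (subst sum_ennreal[symmetric]) (auto simp: p emeasure_eq_measure ennreal_mult)
    also have "\<dots> = emeasure \<mu> E"
      using inv E by (simp add: invariant_measure_def emeasure_eq_measure)
    finally show "emeasure \<mu> E = emeasure (distr (?M \<Otimes>\<^sub>M \<mu>) borel ?T) E" by simp
  qed (simp add: sets_mu)
  have int: "integrable (?M \<Otimes>\<^sub>M \<mu>) (\<lambda>(b, x). f (ifs_map R b x))"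
  proof (rule PF.integrable_const_bound[where B=K])
    have "(\<lambda>z. f (?T z)) \<in> borel_measurable (?M \<Otimes>\<^sub>M \<mu>)" by measurable
    then show "(\<lambda>(b, x). f (ifs_map R b x)) \<in> borel_measurable (?M \<Otimes>\<^sub>M \<mu>)"
      by (simp add: case_prod_beta')
  qed (auto simp: bd)
  have "integral\<^sup>L \<mu> f = integral\<^sup>L (distr (?M \<Otimes>\<^sub>M \<mu>) borel ?T) f"
    using eq by simp
  also have "\<dots> = (\<integral>z. (case z of (b, x) \<Rightarrow> f (ifs_map R b x)) \<partial>(?M \<Otimes>\<^sub>M \<mu>))"
    by (subst integral_distr) (auto simp: case_prod_beta')
  also have "\<dots> = (\<integral>b. (\<integral>x. f (ifs_map R b x) \<partial>\<mu>) \<partial>?M)"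
    using P.integral_fst'[OF int] by simp
  also have "\<dots> = (\<Sum>b\<in>B. p b *\<^sub>R (\<integral>x. f (ifs_map R b x) \<partial>\<mu>))"
    by (rule lebesgue_integral_point_measure_finite) (use B p in auto)
  finally show ?thesis .
qed

section \<open>Exponentials, the Fourier transform and its functional equation\<close>

lemma norm_expo [simp]: "cmod (expo l x) = 1"
proof -
  have "expo l x = exp (\<i> * of_real (2 * pi * (l \<bullet> x)))" by (simp add: expo_def mult_ac)
  then show ?thesis by (simp only: norm_exp_i_times)
qed

lemma expo_0 [simp]: "expo 0 x = 1" "expo l 0 = 1"
  by (simp_all add: expo_def)

lemma expo_add_left: "expo (l + l') x = expo l x * expo l' x"
  by (simp add: expo_def inner_add_left algebra_simps flip: exp_add)

lemma expo_add_right: "expo l (x + y) = expo l x * expo l y"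
  by (simp add: expo_def inner_add_right algebra_simps flip: exp_add)

lemma expo_uminus: "expo (- l) x = cnj (expo l x)"
  by (simp add: expo_def exp_cnj)

lemma expo_eq_1_iff: "expo l x = 1 \<longleftrightarrow> l \<bullet> x \<in> \<int>"
  by (auto simp: expo_def exp_eq_1 Ints_def)

lemma expo_measurable [measurable]: "expo l \<in> borel_measurable borel"
  unfolding expo_def[abs_def] by (intro borel_measurable_continuous_onI continuous_intros)

text \<open>With this sign, the value at l - l' is the inner product of \<open>expo l\<close> and
  \<open>expo l'\<close>, that is, an entry of the Gram matrix.\<close>

definition fourier :: "(real ^ 'n) measure \<Rightarrow> real ^ 'n \<Rightarrow> complex" where
  "fourier \<mu> l = (\<integral>x. expo l x \<partial>\<mu>)"

text \<open>The Fourier transform of the discrete measure with mass p b at each b in B.\<close>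

definition mask :: "(real ^ 'n) set \<Rightarrow> (real ^ 'n \<Rightarrow> real) \<Rightarrow> real ^ 'n \<Rightarrow> complex" where
  "mask B p l = (\<Sum>b\<in>B. of_real (p b) * expo l b)"

lemma expo_matrix_vector: "expo l (A *v x) = expo (transpose A *v l) x"
  by (simp add: expo_def dot_lmul_matrix)

text \<open>Moving the inverse of R onto the frequency turns \<open>expo l (ifs_map R b x)\<close>
  into a factor depending on b times a factor depending on x.\<close>

lemma fourier_invariant:
  fixes l :: "real ^ 'n"
  assumes "invariant_measure R B p \<mu>" "finite B" "\<And>b. b \<in> B \<Longrightarrow> 0 \<le> p b"
  defines "l' \<equiv> transpose (matrix_inv R) *v l"
  shows "fourier \<mu> l = mask B p l' * fourier \<mu> l'"
proof -
  have "fourier \<mu> l = (\<Sum>b\<in>B. p b *\<^sub>R (\<integral>x. expo l (ifs_map R b x) \<partial>\<mu>))"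
    unfolding fourier_def by (rule invariant_measure_integral[where K=1, OF assms(1,2)]) (use assms in auto)
  also have "\<dots> = (\<Sum>b\<in>B. of_real (p b) * expo l' b * fourier \<mu> l')"
  proof (rule sum.cong[OF refl])
    fix b
    have "expo l (ifs_map R b x) = expo l' b * expo l' x" for x
      by (simp add: ifs_map_def expo_matrix_vector expo_add_right l'_def mult.commute)
    then show "p b *\<^sub>R (\<integral>x. expo l (ifs_map R b x) \<partial>\<mu>) = of_real (p b) * expo l' b * fourier \<mu> l'"
      by (simp add: fourier_def scaleR_conv_of_real)
  qed
  finally show ?thesis by (simp add: mask_def sum_distrib_right)
qed

lemma cmod_fourier_le_1:
  assumes "prob_space \<mu>"
  shows "cmod (fourier \<mu> l) \<le> 1"
proof -
  interpret prob_space \<mu> by fact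
  have "cmod (fourier \<mu> l) \<le> (\<integral>x. cmod (expo l x) \<partial>\<mu>)"
    unfolding fourier_def by (rule integral_norm_bound)
  then show ?thesis by (simp add: prob_space)
qed

lemma fourier_0: "prob_space \<mu> \<Longrightarrow> fourier \<mu> 0 = 1"
  by (simp add: fourier_def prob_space.prob_space)

lemma fourier_uminus: "fourier M (- l) = cnj (fourier M l)"
  by (simp add: fourier_def expo_uminus)

lemma cmod_mask_le_1:
  assumes "\<And>b. b \<in> B \<Longrightarrow> 0 \<le> p b" "sum p B = 1"
  shows "cmod (mask B p l) \<le> 1"
proof -
  have "cmod (mask B p l) \<le> (\<Sum>b\<in>B. cmod (of_real (p b) * expo l b))"
    unfolding mask_def by (rule norm_sum)
  also have "\<dots> = sum p B" using assms(1) by (intro sum.cong) (auto simp: norm_mult)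
  finally show ?thesis using assms(2) by simp
qed

lemma inner_integer_vectors:
  assumes "integer_vector x" "integer_vector y"
  shows "x \<bullet> y \<in> \<int>"
  using assms by (auto simp: inner_vec_def integer_vector_def intro!: Ints_sum Ints_mult)

lemma mask_periodic:
  assumes "\<And>b. b \<in> B \<Longrightarrow> integer_vector b" "integer_vector t"
  shows "mask B p (l + t) = mask B p l"
  unfolding mask_def
proof (rule sum.cong[OF refl])
  fix b assume "b \<in> B"
  then have "expo t b = 1" using assms by (simp add: expo_eq_1_iff inner_integer_vectors)
  then show "of_real (p b) * expo (l + t) b = of_real (p b) * expo l b" by (simp add: expo_add_left)
qed

section \<open>A uniform gap for the mask under one translation\<close>

lemma cmod_convex_comb_less:
  assumes "0 < p" "0 < q" "cmod z = 1" "z \<noteq> 1"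
  shows "cmod (of_real p + of_real q * z) < p + q"
proof -
  have z2: "(Re z)\<^sup>2 + (Im z)\<^sup>2 = 1" using assms(3) by (simp add: cmod_def)
  have "Re z \<le> 1" using complex_Re_le_cmod[of z] assms(3) by simp
  moreover have "Re z \<noteq> 1" using z2 assms(4) by (auto simp: complex_eq_iff)
  ultimately have "p * q * Re z < p * q * 1"
    using assms(1,2) by (intro mult_strict_left_mono) auto
  moreover have "(cmod (of_real p + of_real q * z))\<^sup>2 = p\<^sup>2 + 2 * (p * q * Re z) + q\<^sup>2 * ((Re z)\<^sup>2 + (Im z)\<^sup>2)"
    by (simp add: cmod_power2) (simp add: power2_eq_square algebra_simps)
  ultimately have "(cmod (of_real p + of_real q * z))\<^sup>2 < (p + q)\<^sup>2"
    unfolding z2 power2_sum by linarith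
  then show ?thesis by (rule power2_less_imp_less) (use assms(1,2) in simp)
qed

text \<open>As z0 is not 1, z and z * z0 are never both 1, so at least one summand stays below p +
  q. Compactness of the unit circle makes the loss uniform in z.\<close>

lemma cmod_convex_comb_gap:
  assumes pq: "0 < p" "0 < q" and z0: "cmod z0 = 1" "z0 \<noteq> 1"
  shows "\<exists>s < 2 * (p + q). \<forall>z. cmod z = 1 \<longrightarrow>
    cmod (of_real p + of_real q * z) + cmod (of_real p + of_real q * (z * z0)) \<le> s"
proof -
  let ?f = "\<lambda>z. cmod (of_real p + of_real q * z) + cmod (of_real p + of_real q * (z * z0))"
  have cont: "continuous_on (sphere 0 1) ?f" by (intro continuous_intros)
  have "1 \<in> sphere (0::complex) 1" by simp
  then have ne: "sphere (0::complex) 1 \<noteq> {}" by blast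
  from continuous_attains_sup[OF compact_sphere ne cont]
  obtain y where y: "y \<in> sphere 0 1" "\<And>z. z \<in> sphere 0 1 \<Longrightarrow> ?f z \<le> ?f y"
    by blast
  have le: "cmod (of_real p + of_real q * z) \<le> p + q" if "cmod z = 1" for z
    using norm_triangle_ineq[of "of_real p" "of_real q * z"] that pq by (simp add: norm_mult)
  have cy: "cmod y = 1" using y by simp
  have cyz: "cmod (y * z0) = 1" using cy z0 by (simp add: norm_mult)
  have "?f y < 2 * (p + q)"
  proof (cases "y = 1")
    case True
    then have "cmod (of_real p + of_real q * (y * z0)) < p + q"
      using cmod_convex_comb_less[OF pq z0] by simp
    with le[OF cy] show ?thesis by simp
  next
    case False
    with le[OF cyz] cmod_convex_comb_less[OF pq cy] show ?thesis by simp
  qed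
  with y(2) show ?thesis by (intro exI[of _ "?f y"]) auto
qed

text \<open>Only the frequencies 0 and b matter: translating l by w leaves the phase at 0 equal to 1
  and multiplies the phase at b by \<open>expo w b\<close>, which is not 1. The remaining terms are
  bounded by their total weight.\<close>

lemma mask_gap:
  assumes B: "finite B" "0 \<in> B" "b \<in> B" and p: "\<And>b. b \<in> B \<Longrightarrow> 0 < p b" "sum p B = 1"
    and w: "w \<bullet> b \<notin> \<int>"
  shows "\<exists>\<rho>. 0 \<le> \<rho> \<and> \<rho> < 1 \<and> (\<forall>l. cmod (mask B p l) + cmod (mask B p (l + w)) \<le> 2 * \<rho>)"
proof -
  have "b \<noteq> 0" using w by auto
  have "expo w b \<noteq> 1" using w by (simp add: expo_eq_1_iff)
  with cmod_convex_comb_gap[of "p 0" "p b" "expo w b"] p B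
  obtain s where s: "s < 2 * (p 0 + p b)"
    and s_le: "\<And>z. cmod z = 1 \<Longrightarrow> cmod (of_real (p 0) + of_real (p b) * z)
       + cmod (of_real (p 0) + of_real (p b) * (z * expo w b)) \<le> s"
    by auto
  have split: "sum f B = f 0 + f b + sum f (B - {0, b})" for f :: "_ \<Rightarrow> 'c::ab_group_add"
    using B \<open>b \<noteq> 0\<close> by (simp add: sum_diff)
  have bd: "cmod (mask B p l) \<le> cmod (of_real (p 0) + of_real (p b) * expo l b) + (1 - p 0 - p b)" for l
  proof -
    have "cmod (\<Sum>c\<in>B - {0, b}. of_real (p c) * expo l c) \<le> (\<Sum>c\<in>B - {0, b}. p c)"
      by (rule order.trans[OF norm_sum]) (auto simp: norm_mult intro!: sum_mono dest!: p(1))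
    also have "\<dots> = 1 - p 0 - p b" using split[of p] p(2) by simp
    finally have "cmod (\<Sum>c\<in>B - {0, b}. of_real (p c) * expo l c) \<le> 1 - p 0 - p b" .
    moreover have "mask B p l = (of_real (p 0) + of_real (p b) * expo l b) + (\<Sum>c\<in>B - {0, b}. of_real (p c) * expo l c)"
      by (simp add: mask_def split)
    ultimately show ?thesis using norm_triangle_ineq by (smt (verit))
  qed
  \<comment> \<open>Half of the joint bound \<open>s\<close> for the frequencies 0 and b plus the
    trivial bound for the others at both points l and l + w.\<close>
  define \<rho> where "\<rho> = (s + 2 * (1 - p 0 - p b)) / 2"
  have le: "cmod (mask B p l) + cmod (mask B p (l + w)) \<le> 2 * \<rho>" for l
    using bd[of l] bd[of "l + w"] s_le[of "expo l b"] by (simp add: \<rho>_def expo_add_left)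
  have "0 \<le> cmod (mask B p 0) + cmod (mask B p (0 + w))" by simp
  also have "\<dots> \<le> 2 * \<rho>" by (rule le)
  finally have "0 \<le> \<rho>" by simp
  moreover have "\<rho> < 1" using s by (simp add: \<rho>_def)
  ultimately show ?thesis using le by blast
qed

section \<open>Small averages and sequences of polynomial growth\<close>

lemma integer_vector_add: "integer_vector x \<Longrightarrow> integer_vector y \<Longrightarrow> integer_vector (x + y)"
  by (simp add: integer_vector_def)

text \<open>The list is doubled at each step: t is replaced by U t and U t + u. Since V (U t + y) =
  V y + t with t integral, periodicity makes g (V y) a common factor of one copy. The two copies
  carry g (V x) and g (V x + V u), so the sum grows by at most 2 * \<open>\<rho>\<close> while the
  length doubles.\<close>

lemma exponentially_small_averages:
  fixes \<phi> g :: "real ^ 'n \<Rightarrow> real" and U V :: "real ^ 'n \<Rightarrow> real ^ 'n"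
  assumes \<phi>: "\<And>x. 0 \<le> \<phi> x" "\<And>x. \<phi> x \<le> 1" "\<And>x. \<phi> x \<le> g (V x) * \<phi> (V x)"
    and g: "\<And>x. 0 \<le> g x" "\<And>x t. integer_vector t \<Longrightarrow> g (x + t) = g x"
      "\<And>x. g x + g (x + V u) \<le> 2 * \<rho>"
    and V: "linear V" "\<And>x. V (U x) = x"
    and U: "\<And>x. integer_vector x \<Longrightarrow> integer_vector (U x)" "\<And>x. norm (U x) \<le> Q * norm x"
    and u: "integer_vector u" "norm u \<le> 1" and Q: "2 \<le> Q" and \<rho>: "0 \<le> \<rho>"
  shows "\<exists>ts. length ts = 2 ^ n \<and> (\<forall>t\<in>set ts. integer_vector t \<and> norm t \<le> Q ^ n - 1) \<and>
    (\<forall>x. (\<Sum>t\<leftarrow>ts. \<phi> (t + x)) \<le> (2 * \<rho>) ^ n)"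
proof (induction n)
  case 0
  show ?case by (rule exI[of _ "[0]"]) (simp add: \<phi> integer_vector_def)
next
  case (Suc n)
  then obtain ts where ts: "length ts = 2 ^ n" "\<And>t. t \<in> set ts \<Longrightarrow> integer_vector t"
    "\<And>t. t \<in> set ts \<Longrightarrow> norm t \<le> Q ^ n - 1" "\<And>x. (\<Sum>t\<leftarrow>ts. \<phi> (t + x)) \<le> (2 * \<rho>) ^ n"
    by blast
  let ?ts = "map U ts @ map (\<lambda>t. U t + u) ts"
  have sum_le: "(\<Sum>t\<leftarrow>ts. \<phi> (U t + y)) \<le> g (V y) * (2 * \<rho>) ^ n" for y
  proof -
    have "(\<Sum>t\<leftarrow>ts. \<phi> (U t + y)) \<le> (\<Sum>t\<leftarrow>ts. g (V y) * \<phi> (t + V y))"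
    proof (rule sum_list_mono)
      fix t assume "t \<in> set ts"
      have Vy: "V (U t + y) = V y + t" using V by (simp add: linear_add add.commute)
      show "\<phi> (U t + y) \<le> g (V y) * \<phi> (t + V y)"
        using \<phi>(3)[of "U t + y"] unfolding Vy g(2)[OF ts(2)[OF \<open>t \<in> set ts\<close>], of "V y"]
        by (simp only: add.commute)
    qed
    also have "\<dots> = g (V y) * (\<Sum>t\<leftarrow>ts. \<phi> (t + V y))" by (rule sum_list_const_mult)
    also have "\<dots> \<le> g (V y) * (2 * \<rho>) ^ n" using ts(4) g(1) by (rule mult_left_mono)
    finally show ?thesis .
  qed
  have "(\<Sum>t\<leftarrow>?ts. \<phi> (t + x)) \<le> (2 * \<rho>) ^ Suc n" for x
  proof -
    have "(\<Sum>t\<leftarrow>?ts. \<phi> (t + x)) = (\<Sum>t\<leftarrow>ts. \<phi> (U t + x)) + (\<Sum>t\<leftarrow>ts. \<phi> (U t + (x + u)))"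
      by (simp add: o_def add_ac)
    also have "\<dots> \<le> g (V x) * (2 * \<rho>) ^ n + g (V x + V u) * (2 * \<rho>) ^ n"
      using sum_le[of x] sum_le[of "x + u"] V(1) by (simp add: linear_add)
    also have "\<dots> = (g (V x) + g (V x + V u)) * (2 * \<rho>) ^ n" by (simp add: distrib_right)
    also have "\<dots> \<le> 2 * \<rho> * (2 * \<rho>) ^ n" using \<rho> by (intro mult_right_mono g(3)) auto
    finally show ?thesis by simp
  qed
  \<comment> \<open>The surplus -1 in the norm bound becomes -Q, hence at most -2, which leaves room
    for adding \<open>u\<close> of norm at most 1.\<close>
  moreover have "norm (U t) \<le> Q ^ Suc n - 2" if "t \<in> set ts" for t
  proof -
    have "norm (U t) \<le> Q * norm t" by (rule U)
    also have "\<dots> \<le> Q * (Q ^ n - 1)" using ts(3)[OF that] Q by (intro mult_left_mono) auto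
    also have "\<dots> \<le> Q ^ Suc n - 2" using Q by (simp add: algebra_simps)
    finally show ?thesis .
  qed
  then have "norm (U t) \<le> Q ^ Suc n - 1" "norm (U t + u) \<le> Q ^ Suc n - 1" if "t \<in> set ts" for t
    using that u(2) norm_triangle_ineq[of "U t" u] by force+
  ultimately show ?case
    by (intro exI[of _ ?ts]) (auto simp: ts U(1) u(1) integer_vector_add)
qed

text \<open>The bound on the averages is uniform in x, so it applies to every translate by -f i.
  Summing over i bounds the mean over the list, and some entry does not exceed the mean.\<close>

lemma exists_small_of_averages:
  fixes \<phi> :: "real ^ 'n \<Rightarrow> real"
  assumes ts: "length ts = 2 ^ m" "\<And>x. (\<Sum>t\<leftarrow>ts. \<phi> (t + x)) \<le> (2 * \<rho>) ^ m"
  shows "\<exists>t\<in>set ts. (\<Sum>i<n. \<phi> (t - f i)) \<le> real n * \<rho> ^ m"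
proof (rule ccontr)
  assume "\<not> ?thesis"
  then have less: "real n * \<rho> ^ m < (\<Sum>i<n. \<phi> (t - f i))" if "t \<in> set ts" for t
    using that by force
  have "ts \<noteq> []" using ts(1) by auto
  then have "(\<Sum>t\<leftarrow>ts. real n * \<rho> ^ m) < (\<Sum>t\<leftarrow>ts. \<Sum>i<n. \<phi> (t - f i))"
    using less by (intro sum_list_strict_mono) auto
  also have "\<dots> = (\<Sum>i<n. \<Sum>t\<leftarrow>ts. \<phi> (t - f i))"
    by (induction ts) (simp_all add: sum.distrib)
  also have "\<dots> \<le> (\<Sum>i<n. (2 * \<rho>) ^ m)"
    using ts(2)[of "- f _"] by (intro sum_mono) simp
  also have "\<dots> = (\<Sum>t\<leftarrow>ts. real n * \<rho> ^ m)"
    by (simp add: sum_list_triv ts(1) power_mult_distrib mult_ac)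
  finally show False by simp
qed

text \<open>Greedy choice: for s n, averages are taken at level a * L with 2^L comparable to n + 2.
  Smallness and norm are both exponential in L, hence polynomial in n.\<close>

lemma polynomial_growth_sequence:
  fixes \<phi> :: "real ^ 'n \<Rightarrow> real"
  assumes \<rho>: "0 \<le> \<rho>" "\<rho> < 1"
    and avg: "\<And>m. \<exists>ts. length ts = 2 ^ m \<and> (\<forall>t\<in>set ts. norm t \<le> Q ^ m) \<and>
      (\<forall>x. (\<Sum>t\<leftarrow>ts. \<phi> (t + x)) \<le> (2 * \<rho>) ^ m)"
  shows "\<exists>(s :: nat \<Rightarrow> real ^ 'n) \<kappa>. 0 < \<kappa> \<and> (\<forall>n. norm (s n) \<le> (2 * (real n + 2)) ^ \<kappa>) \<and>
    (\<forall>n. (\<Sum>i<n. \<phi> (s n - s i)) \<le> 1 / (4 * (real n + 1) * (real n + 2)))"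
proof -
  \<comment> \<open>As 16 = 2^4, this yields \<open>\<rho> ^ (a * L)\<close> at most 1 / (n + 2)^4,
    enough to absorb the n summands and still leave quadratic decay.\<close>
  obtain a where a: "\<rho> ^ a < 1 / 16" using real_arch_pow_inv[of "1/16" \<rho>] \<rho> by auto
  have "a \<noteq> 0" using a by (intro notI) simp
  \<comment> \<open>The maximum with 2 ensures that e, and with it the growth exponent e * a, is
    positive.\<close>
  obtain e where e: "max \<bar>Q\<bar> 2 < 2 ^ e" using real_arch_pow[of 2 "max \<bar>Q\<bar> 2"] by auto
  have "e \<noteq> 0" using e by (intro notI) auto
  let ?\<kappa> = "e * a"
  have ex: "\<exists>t. norm t \<le> (2 * (real n + 2)) ^ ?\<kappa> \<and>
    (\<Sum>i<n. \<phi> (t - f i)) \<le> 1 / (4 * (real n + 1) * (real n + 2))" for n f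
  proof -
    \<comment> \<open>L is the binary logarithm of n + 2 rounded up; minimality gives the upper
      bound. Starting from n + 2 guarantees L > 0.\<close>
    obtain L where L: "n + 2 \<le> 2 ^ L" "2 ^ L \<le> 2 * (n + 2)"
    proof -
      have "n + 2 < 2 ^ (n + 2)" by (rule less_exp)
      then have ex: "\<exists>L. n + 2 \<le> 2 ^ L" by (metis less_imp_le)
      define L where "L = (LEAST L. n + 2 \<le> 2 ^ L)"
      have L: "n + 2 \<le> 2 ^ L" unfolding L_def using ex by (rule LeastI_ex)
      then have "L \<noteq> 0" by (intro notI) simp
      then obtain L' where L': "L = Suc L'" by (cases L) auto
      then have "\<not> n + 2 \<le> 2 ^ L'" unfolding L_def by (metis not_less_Least lessI)
      then have "2 ^ L \<le> 2 * (n + 2)" by (simp add: L')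
      with L show thesis by (rule that)
    qed
    have L': "real n + 2 \<le> 2 ^ L" "2 ^ L \<le> 2 * (real n + 2)"
      using L(1)[THEN of_nat_mono[where 'a=real]] L(2)[THEN of_nat_mono[where 'a=real]] by simp_all
    obtain ts where ts: "length ts = 2 ^ (a * L)" "\<And>t. t \<in> set ts \<Longrightarrow> norm t \<le> Q ^ (a * L)"
      "\<And>x. (\<Sum>t\<leftarrow>ts. \<phi> (t + x)) \<le> (2 * \<rho>) ^ (a * L)"
      using avg[of "a * L"] by blast
    obtain t where t: "t \<in> set ts" "(\<Sum>i<n. \<phi> (t - f i)) \<le> real n * \<rho> ^ (a * L)"
      using exists_small_of_averages[OF ts(1,3)] by blast
    have "norm t \<le> \<bar>Q\<bar> ^ (a * L)"
      using ts(2)[OF t(1)] by (metis abs_ge_self order.trans power_abs)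
    also have "\<dots> \<le> (2 ^ e) ^ (a * L)" using e by (intro power_mono) auto
    also have "\<dots> = (2 ^ L) ^ ?\<kappa>" by (simp add: mult_ac flip: power_mult)
    also have "\<dots> \<le> (2 * (real n + 2)) ^ ?\<kappa>" using L' by (intro power_mono) auto
    finally have norm: "norm t \<le> (2 * (real n + 2)) ^ ?\<kappa>" .
    have "\<rho> ^ (a * L) \<le> (1 / 16) ^ L"
      unfolding power_mult using a \<rho> by (intro power_mono) auto
    also have "\<dots> = 1 / (2 ^ L) ^ 4"
    proof -
      have "(16 :: real) ^ L = (2 ^ 4) ^ L" by simp
      also have "\<dots> = (2 ^ L) ^ 4" by (simp only: mult.commute flip: power_mult)
      finally show ?thesis by (simp add: power_divide)
    qed
    also have "\<dots> \<le> 1 / (real n + 2) ^ 4"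
      using L' by (intro divide_left_mono power_mono) auto
    finally have "real n * \<rho> ^ (a * L) \<le> real n * (1 / (real n + 2) ^ 4)"
      by (intro mult_left_mono) auto
    also have "\<dots> \<le> 1 / (4 * (real n + 1) * (real n + 2))"
    proof -
      have "4 * x * (x + 1) * (x + 2) \<le> (x + 2) ^ 4" if "0 \<le> x" for x :: real
      proof -
        have "(x + 2) ^ 4 - 4 * x * (x + 1) * (x + 2) = (x + 2) * (x * x * x + 2 * x * x + 8 * x + 8)"
          by (simp add: power4_eq_xxxx algebra_simps)
        also have "0 \<le> \<dots>" using that by auto
        finally show ?thesis by simp
      qed
      from this[of "real n"] have "real n * (4 * (real n + 1) * (real n + 2)) \<le> (real n + 2) ^ 4"
        by (simp only: mult_ac of_nat_0_le_iff)
      then have "real n \<le> (real n + 2) ^ 4 / (4 * (real n + 1) * (real n + 2))"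
        by (subst pos_le_divide_eq) auto
      then show ?thesis
        by (subst times_divide_eq_right, subst pos_divide_le_eq) auto
    qed
    finally show ?thesis using t(2) norm by (intro exI[of _ t]) auto
  qed
  \<comment> \<open>\<open>ex\<close> holds for every f, so s n can be chosen by well-founded
    recursion with f equal to the part already constructed; only values at i < n enter.\<close>
  have "\<exists>s. \<forall>n. norm (s n) \<le> (2 * (real n + 2)) ^ ?\<kappa> \<and>
    (\<Sum>i<n. \<phi> (s n - s i)) \<le> 1 / (4 * (real n + 1) * (real n + 2))"
    by (rule dependent_wf_choice[OF wf_less_than]) (use ex in \<open>auto intro!: sum.cong\<close>)
  moreover have "0 < ?\<kappa>" using \<open>a \<noteq> 0\<close> \<open>e \<noteq> 0\<close> by simp
  ultimately show ?thesis by blast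
qed

text \<open>With r = 1/\<open>\<kappa>\<close>, the cube of half-side h around 0 contains s n
  whenever 2 * (n + 2) is at most h^r. These are of order h^r distinct points, so the density for
  this r is positive.\<close>

lemma upper_beurling_dim_pos:
  fixes s :: "nat \<Rightarrow> real ^ 'n"
  assumes inj: "inj s" and \<kappa>: "0 < \<kappa>" and s: "\<And>n. norm (s n) \<le> (2 * (real n + 2)) ^ \<kappa>"
  shows "0 < upper_beurling_dim (range s)"
proof -
  define r where "r = 1 / real \<kappa>"
  have "0 < r" using \<kappa> by (simp add: r_def)
  let ?f = "\<lambda>h :: real. SUP x :: real ^ 'n.
       emeasure (count_space UNIV) (range s \<inter> {y. \<forall>i. \<bar>y $ i - x $ i\<bar> \<le> h}) / ennreal (h powr r)"
  \<comment> \<open>The threshold gives h^r at least 12, exactly what makes h^r / 2 - 3 at least h^r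
    / 4; the 3 accounts for the floor and for the shift by 2.\<close>
  have "ennreal (1/4) \<le> ?f h" if h: "12 ^ \<kappa> \<le> h" for h
  proof -
    have "0 < h" using h by (rule less_le_trans[rotated]) simp
    have pow: "(h powr r) ^ \<kappa> = h"
      using \<open>0 < h\<close> \<kappa> by (simp add: r_def powr_powr flip: powr_realpow)
    have "12 \<le> h powr r"
    proof (rule ccontr)
      assume "\<not> ?thesis"
      then have "(h powr r) ^ \<kappa> < 12 ^ \<kappa>" using \<kappa> by (intro power_strict_mono) auto
      with h pow show False by simp
    qed
    define k where "k = nat \<lfloor>h powr r / 2\<rfloor> - 2"
    have k: "h powr r / 4 \<le> real k" "2 * (real k + 2) \<le> h powr r"
    proof -
      have "6 \<le> \<lfloor>h powr r / 2\<rfloor>" using \<open>12 \<le> h powr r\<close> by linarith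
      then have "real k = of_int \<lfloor>h powr r / 2\<rfloor> - 2" by (simp add: k_def of_nat_diff nat_le_iff le_nat_iff)
      then show "h powr r / 4 \<le> real k" using \<open>12 \<le> h powr r\<close> by linarith
      show "2 * (real k + 2) \<le> h powr r"
        using \<open>real k = _\<close> of_int_floor_le[of "h powr r / 2"] by simp
    qed
    let ?Q = "range s \<inter> {y. \<forall>i. \<bar>y $ i - (0 :: real ^ 'n) $ i\<bar> \<le> h}"
    have "s ` {..<k} \<subseteq> ?Q"
    proof safe
      fix n i assume "n < k"
      have "\<bar>s n $ i\<bar> \<le> norm (s n)" by (rule component_le_norm_cart)
      also have "\<dots> \<le> (2 * (real n + 2)) ^ \<kappa>" by (rule s)
      also have "\<dots> \<le> (h powr r) ^ \<kappa>" using k(2) \<open>n < k\<close> by (intro power_mono) auto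
      finally show "\<bar>s n $ i - 0 $ i\<bar> \<le> h" by (simp add: pow)
    qed auto
    then have "emeasure (count_space UNIV) (s ` {..<k}) \<le> emeasure (count_space UNIV) ?Q"
      by (intro emeasure_mono) auto
    moreover have "emeasure (count_space UNIV) (s ` {..<k}) = ennreal (real k)"
      using inj by (subst emeasure_count_space_finite)
        (auto simp: card_image inj_on_subset ennreal_of_nat_eq_real_of_nat)
    ultimately have "ennreal (real k) / ennreal (h powr r) \<le> emeasure (count_space UNIV) ?Q / ennreal (h powr r)"
      by (intro divide_right_mono_ennreal) simp
    moreover have "1 / 4 \<le> real k / h powr r"
      using k(1) \<open>12 \<le> h powr r\<close> by (subst pos_le_divide_eq) auto
    then have "ennreal (1/4) \<le> ennreal (real k) / ennreal (h powr r)"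
      using \<open>12 \<le> h powr r\<close> by (subst divide_ennreal) (auto intro: ennreal_leI)
    ultimately have "ennreal (1/4) \<le> emeasure (count_space UNIV) ?Q / ennreal (h powr r)" by (rule order.trans[rotated])
    then show ?thesis by (rule SUP_upper2[OF UNIV_I])
  qed
  then have "eventually (\<lambda>h. ennreal (1/4) \<le> ?f h) at_top"
    unfolding eventually_at_top_linorder by blast
  then have "Limsup at_top (\<lambda>h :: real. ennreal (1/4)) \<le> Limsup at_top ?f" by (rule Limsup_mono)
  then have "ennreal (1/4) \<le> upper_beurling_density r (range s)"
    by (simp add: upper_beurling_density_def Limsup_const)
  then have "0 < upper_beurling_density r (range s)"
    by (rule less_le_trans[rotated]) simp
  with \<open>0 < r\<close> have "ennreal r \<le> upper_beurling_dim (range s)"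
    unfolding upper_beurling_dim_def by (intro SUP_upper) simp
  then show ?thesis by (rule less_le_trans[rotated]) (simp add: \<open>0 < r\<close>)
qed

section \<open>Almost orthogonal exponentials\<close>

text \<open>Expanding the square gives the quadratic form of the Gram matrix. Its diagonal entries
  are \<open>fourier \<mu> 0\<close> = 1, and each product |c l| |c l'| is at most the full sum of
  squares, so the sum of the off-diagonal moduli controls the error.\<close>

lemma gram_near_identity:
  fixes c :: "real ^ 'n \<Rightarrow> complex"
  assumes "prob_space \<mu>" "sets \<mu> = sets borel" "finite F"
    and off: "(\<Sum>l\<in>F. \<Sum>l'\<in>F - {l}. cmod (fourier \<mu> (l - l'))) \<le> \<epsilon>"
  shows "\<bar>(\<integral>x. (cmod (\<Sum>l\<in>F. c l * expo l x))\<^sup>2 \<partial>\<mu>) - (\<Sum>l\<in>F. (cmod (c l))\<^sup>2)\<bar>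
    \<le> \<epsilon> * (\<Sum>l\<in>F. (cmod (c l))\<^sup>2)"
proof -
  interpret prob_space \<mu> by fact
  note assms(2) [measurable_cong]
  let ?N = "\<Sum>l\<in>F. (cmod (c l))\<^sup>2"
  let ?I = "\<integral>x. (cmod (\<Sum>l\<in>F. c l * expo l x))\<^sup>2 \<partial>\<mu>"
  let ?g = "\<lambda>l l'. c l * cnj (c l') * fourier \<mu> (l - l')"
  have int: "integrable \<mu> (expo l)" for l
    by (rule integrable_const_bound[where B=1]) auto
  have pt: "complex_of_real ((cmod (\<Sum>l\<in>F. c l * expo l x))\<^sup>2)
      = (\<Sum>l\<in>F. \<Sum>l'\<in>F. c l * cnj (c l') * expo (l - l') x)" for x
    unfolding complex_norm_square
    by (simp add: sum_product diff_conv_add_uminus expo_add_left expo_uminus mult_ac del: add_uminus_conv_diff)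
  have "complex_of_real ?I = (\<integral>x. complex_of_real ((cmod (\<Sum>l\<in>F. c l * expo l x))\<^sup>2) \<partial>\<mu>)"
    by (rule integral_complex_of_real[symmetric])
  also have "\<dots> = (\<integral>x. (\<Sum>l\<in>F. \<Sum>l'\<in>F. c l * cnj (c l') * expo (l - l') x) \<partial>\<mu>)"
    unfolding pt ..
  also have "\<dots> = (\<Sum>l\<in>F. \<Sum>l'\<in>F. ?g l l')"
    by (simp add: Bochner_Integration.integral_sum Bochner_Integration.integrable_sum int fourier_def)
  also have "\<dots> = (\<Sum>l\<in>F. ?g l l + (\<Sum>l'\<in>F - {l}. ?g l l'))"
    using assms(3) by (intro sum.cong refl sum.remove) auto
  also have "\<dots> = complex_of_real ?N + (\<Sum>l\<in>F. \<Sum>l'\<in>F - {l}. ?g l l')"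
    unfolding of_real_sum complex_norm_square
    by (simp add: sum.distrib fourier_0[OF assms(1)])
  finally have "complex_of_real (?I - ?N) = (\<Sum>l\<in>F. \<Sum>l'\<in>F - {l}. ?g l l')" by simp
  from arg_cong[OF this, of cmod]
  have "\<bar>?I - ?N\<bar> = cmod (\<Sum>l\<in>F. \<Sum>l'\<in>F - {l}. ?g l l')"
    unfolding norm_of_real .
  also have "\<dots> \<le> (\<Sum>l\<in>F. \<Sum>l'\<in>F - {l}. cmod (?g l l'))"
    by (intro order.trans[OF norm_sum] sum_mono norm_sum)
  also have "\<dots> \<le> (\<Sum>l\<in>F. \<Sum>l'\<in>F - {l}. ?N * cmod (fourier \<mu> (l - l')))"
  proof (intro sum_mono)
    fix l l' assume "l \<in> F" "l' \<in> F - {l}"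
    then have "(cmod (c l))\<^sup>2 \<le> ?N" "(cmod (c l'))\<^sup>2 \<le> ?N"
      using assms(3) by (auto intro: member_le_sum)
    moreover have "2 * (cmod (c l) * cmod (c l')) \<le> (cmod (c l))\<^sup>2 + (cmod (c l'))\<^sup>2"
      using sum_squares_bound[of "cmod (c l)" "cmod (c l')"] by simp
    ultimately have "cmod (c l) * cmod (c l') \<le> ?N" by linarith
    then show "cmod (?g l l') \<le> ?N * cmod (fourier \<mu> (l - l'))"
      by (simp add: norm_mult mult_right_mono)
  qed
  also have "\<dots> = (\<Sum>l\<in>F. \<Sum>l'\<in>F - {l}. cmod (fourier \<mu> (l - l'))) * ?N"
    by (simp add: sum_distrib_left mult.commute)
  also have "\<dots> \<le> \<epsilon> * ?N" using off by (intro mult_right_mono sum_nonneg) auto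
  finally show ?thesis .
qed

text \<open>Evenness makes the two orders of each pair contribute equally. In the induction, index N
  adds one new row and one entry to every earlier row.\<close>

lemma off_diagonal_sum_le:
  fixes s :: "nat \<Rightarrow> 'a::ab_group_add" and \<phi> :: "'a \<Rightarrow> real"
  assumes even: "\<And>x. \<phi> (- x) = \<phi> x"
  shows "(\<Sum>i<N. \<Sum>j\<in>{..<N} - {i}. \<phi> (s i - s j)) = 2 * (\<Sum>n<N. \<Sum>i<n. \<phi> (s n - s i))"
proof (induction N)
  case (Suc N)
  have "(\<Sum>j\<in>{..<Suc N} - {i}. \<phi> (s i - s j)) = (\<Sum>j\<in>{..<N} - {i}. \<phi> (s i - s j)) + \<phi> (s N - s i)"
    if "i < N" for i
  proof -
    have "{..<Suc N} - {i} = insert N ({..<N} - {i})" using that by auto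
    then show ?thesis using even[of "s i - s N"] by simp
  qed
  moreover have "{..<Suc N} - {N} = {..<N}" by auto
  ultimately show ?case using Suc by (simp add: sum.distrib)
qed simp

text \<open>The prescribed bounds sum to less than 1/4, hence to at most 1/2 over ordered pairs. A
  coincidence s n = s i would contribute |F(0)| = 1 to a sum below 1, which gives
  injectivity.\<close>

lemma riesz_basic_spectrum_of_small_off_diagonal:
  fixes s :: "nat \<Rightarrow> real ^ 'n"
  assumes mu: "prob_space \<mu>" "sets \<mu> = sets borel"
    and s: "\<And>n. (\<Sum>i<n. cmod (fourier \<mu> (s n - s i))) \<le> 1 / (4 * (real n + 1) * (real n + 2))"
  shows "inj s" "riesz_basic_spectrum \<mu> (range s)"
proof -
  interpret prob_space \<mu> by fact
  let ?\<phi> = "\<lambda>l. cmod (fourier \<mu> l)"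
  have ne: "s n \<noteq> s i" if "i < n" for i n
  proof
    assume eq: "s n = s i"
    have "?\<phi> (s n - s i) \<le> (\<Sum>i<n. ?\<phi> (s n - s i))"
      by (rule member_le_sum) (use that in auto)
    also have "\<dots> \<le> 1 / (4 * (real n + 1) * (real n + 2))" by (rule s)
    also have "\<dots> < 1"
    proof -
      have "1 < 4 * (real n + 1) * (real n + 2)" by (simp add: algebra_simps add_pos_nonneg)
      then show ?thesis by simp
    qed
    finally show False by (simp add: eq fourier_0[OF mu(1)])
  qed
  then show inj: "inj s" by (metis injI nat_neq_iff)
  have even: "?\<phi> (- x) = ?\<phi> x" for x by (simp add: fourier_uminus)
  have off: "(\<Sum>l\<in>F. \<Sum>l'\<in>F - {l}. ?\<phi> (l - l')) \<le> 1 / 2" if F: "finite F" "F \<subseteq> range s" for F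
  proof -
    \<comment> \<open>The double sum over F is moved to indices and enlarged to an initial segment,
      where it splits into the sums over i < n.\<close>
    from finite_subset_image[OF F] obtain I where I: "finite I" "F = s ` I" by auto
    obtain N where N: "I \<subseteq> {..<N}" using I(1) by (auto simp: finite_nat_iff_bounded)
    have "(\<Sum>l\<in>F. \<Sum>l'\<in>F - {l}. ?\<phi> (l - l')) = (\<Sum>i\<in>I. \<Sum>l'\<in>s ` (I - {i}). ?\<phi> (s i - l'))"
      unfolding I(2) using inj
      by (subst sum.reindex) (auto intro: inj_on_subset simp: image_set_diff)
    also have "\<dots> = (\<Sum>i\<in>I. \<Sum>j\<in>I - {i}. ?\<phi> (s i - s j))"
      using inj by (subst sum.reindex) (auto intro: inj_on_subset)
    also have "\<dots> \<le> (\<Sum>i\<in>I. \<Sum>j\<in>{..<N} - {i}. ?\<phi> (s i - s j))"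
      using N by (intro sum_mono sum_mono2) auto
    also have "\<dots> \<le> (\<Sum>i<N. \<Sum>j\<in>{..<N} - {i}. ?\<phi> (s i - s j))"
      using N by (intro sum_mono2 sum_nonneg) auto
    also have "\<dots> = 2 * (\<Sum>n<N. \<Sum>i<n. ?\<phi> (s n - s i))"
      using even by (rule off_diagonal_sum_le)
    also have "\<dots> \<le> 2 * (\<Sum>n<N. 1 / (4 * (real n + 1) * (real n + 2)))"
      using s by (intro mult_left_mono sum_mono) auto
    \<comment> \<open>Telescoping by partial fractions; this is what the shape of the prescribed
      bounds is for.\<close>
    also have "(\<Sum>n<N. 1 / (4 * (real n + 1) * (real n + 2))) = 1 / 4 * (1 - 1 / (real N + 1))"
    proof (induction N)
      case (Suc N)
      have "1 / (4 * (real N + 1) * (real N + 2)) = 1 / 4 * (1 / (real N + 1) - 1 / (real N + 2))"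
        by (simp add: divide_simps)
      with Suc show ?case by (simp add: algebra_simps)
    qed simp
    also have "2 * \<dots> \<le> 1 / 2" by simp
    finally show ?thesis .
  qed
  \<comment> \<open>An error of at most 1/2 puts the squared norm between 1/2 and 3/2 times the sum
    of squares.\<close>
  have bounds: "sqrt (1/2) * sqrt (\<Sum>l\<in>F. (cmod (c l))\<^sup>2) \<le> L2_norm \<mu> (\<lambda>x. \<Sum>l\<in>F. c l * expo l x) \<and>
      L2_norm \<mu> (\<lambda>x. \<Sum>l\<in>F. c l * expo l x) \<le> sqrt (3/2) * sqrt (\<Sum>l\<in>F. (cmod (c l))\<^sup>2)"
    if F: "finite F" "F \<subseteq> range s" for F c
    using gram_near_identity[OF mu F(1) off[OF F], of c]
    unfolding L2_norm_def real_sqrt_mult[symmetric] real_sqrt_le_iff abs_le_iff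
    by linarith
  have "countable (range s)" by simp
  then show "riesz_basic_spectrum \<mu> (range s)"
    unfolding riesz_basic_spectrum_def using bounds
    by (intro conjI exI[of _ "sqrt (1/2)"] exI[of _ "sqrt (3/2)"]) auto
qed

section \<open>Application to the invariant measure\<close>

lemma integer_matrix_mult_vector:
  assumes "integer_matrix A" "integer_vector x"
  shows "integer_vector (A *v x)"
  unfolding integer_vector_def matrix_vector_mult_def
proof
  fix i
  have "(\<Sum>j\<in>UNIV. A $ i $ j * x $ j) \<in> \<int>"
    by (intro Ints_sum Ints_mult) (use assms in \<open>simp_all add: integer_matrix_def integer_vector_def\<close>)
  then show "(\<chi> i. \<Sum>j\<in>UNIV. A $ i $ j * x $ j) $ i \<in> \<int>" by simp
qed

theorem theorem2p1:
  fixes R :: "real ^ 'n ^ 'n"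
    and B :: "(real ^ 'n) set"
    and p :: "real ^ 'n \<Rightarrow> real"
    and \<mu> :: "(real ^ 'n) measure"
  assumes "integer_matrix R"
    and "expansive R"
    and "finite B"
    and "\<forall>b\<in>B. integer_vector b"
    and "0 \<in> B"
    and "2 \<le> card B"
    and "\<forall>b\<in>B. 0 < p b \<and> p b < 1"
    and "(\<Sum>b\<in>B. p b) = 1"
    and "invariant_measure R B p \<mu>"
  shows "\<exists>\<Lambda> :: (real ^ 'n) set.
           infinite \<Lambda> \<and> riesz_basic_spectrum \<mu> \<Lambda> \<and> 0 < upper_beurling_dim \<Lambda>"
proof -
  have mu: "prob_space \<mu>" "sets \<mu> = sets borel"
    using assms(9) by (simp_all add: invariant_measure_def)
  interpret prob_space \<mu> by (rule mu)
  have p: "\<And>b. b \<in> B \<Longrightarrow> 0 < p b" "\<And>b. b \<in> B \<Longrightarrow> 0 \<le> p b" using assms(7) by (auto intro: less_imp_le)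
  define A where "A = matrix_inv R"
  have "invertible R" using assms(2) by (rule expansive_invertible)
  then have RA: "R ** A = mat 1"
    unfolding A_def matrix_inv_def invertible_def by (metis (mono_tags, lifting) someI_ex)
  have "\<exists>b\<in>B. b \<noteq> 0"
  proof (rule ccontr)
    assume "\<not> ?thesis"
    with assms(5) have "B = {0}" by blast
    with assms(6) show False by simp
  qed
  then obtain b where b: "b \<in> B" "b \<noteq> 0" by blast
  obtain M i where Mi: "((*v) A ^^ M) b $ i \<notin> \<int>"
    using expansive_inverse_power_not_integer[OF assms(2) RA b(2)] by (auto simp: integer_vector_def)
  \<comment> \<open>b itself is integral. A positive M is needed so that M steps of the functional
    equation produce at least one mask factor.\<close>
  with assms(4) b(1) have "M \<noteq> 0" by (intro notI) (auto simp: integer_vector_def)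
  then obtain M' where M': "M = Suc M'" by (cases M) auto
  let ?S = "(*v) (transpose R)" and ?T = "(*v) (transpose A)"
  let ?U = "?S ^^ M" and ?V = "?T ^^ M"
  \<comment> \<open>The unit vector reads off the non-integral coordinate: the inner product of
    \<open>?V u\<close> and b is the i-th coordinate of A^M b.\<close>
  define u :: "real ^ 'n" where "u = axis i 1"
  let ?\<phi> = "\<lambda>l. cmod (fourier \<mu> l)" and ?g = "\<lambda>l. cmod (mask B p l)"
  have g1: "?g l \<le> 1" for l using p(2) assms(8) by (rule cmod_mask_le_1)
  have \<phi>_eq: "?\<phi> l = ?g (?T l) * ?\<phi> (?T l)" for l
    using fourier_invariant[OF assms(9,3) p(2), of l] by (simp add: A_def norm_mult)
  \<comment> \<open>The first M' = M - 1 mask factors are bounded by 1; only the last one, at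
    \<open>?V l\<close>, is kept to supply the gap.\<close>
  have \<phi>_le: "?\<phi> l \<le> ?\<phi> ((?T ^^ k) l)" for k l
  proof (induction k)
    case (Suc k)
    have "?\<phi> ((?T ^^ k) l) \<le> 1 * ?\<phi> ((?T ^^ Suc k) l)"
      unfolding \<phi>_eq[of "(?T ^^ k) l"] using g1 by (intro mult_mono) auto
    with Suc show ?case by (simp del: transpose_matrix_vector)
  qed simp
  have inner: "(?T ^^ k) l \<bullet> x = l \<bullet> ((*v) A ^^ k) x" for k l x
  proof (induction k arbitrary: x)
    case (Suc k)
    have "(?T ^^ Suc k) l \<bullet> x = (?T ^^ k) l \<bullet> (A *v x)"
      by (simp add: dot_lmul_matrix)
    also have "\<dots> = l \<bullet> ((*v) A ^^ Suc k) x"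
      unfolding Suc by (simp add: funpow_swap1)
    finally show ?case .
  qed simp
  have "?V u \<bullet> b = ((*v) A ^^ M) b $ i" unfolding inner by (simp add: u_def inner_axis')
  with Mi have w: "?V u \<bullet> b \<notin> \<int>" by simp
  from mask_gap[OF assms(3,5) b(1) p(1) assms(8) w]
  obtain \<rho> where \<rho>: "0 \<le> \<rho>" "\<rho> < 1" "\<And>l. ?g l + ?g (l + ?V u) \<le> 2 * \<rho>" by blast
  have lin: "linear (f ^^ k)" if "linear f" for f :: "real ^ 'n \<Rightarrow> real ^ 'n" and k
  proof (induction k)
    case (Suc k)
    from linear_compose[OF this that] show ?case by (simp only: funpow.simps)
  qed (simp add: linear_iff)
  have VU: "?V (?U x) = x" for x
  proof -
    have "?T (?S y) = y" for y
      unfolding matrix_vector_mul_assoc matrix_transpose_mul[symmetric] RA by simp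
    moreover have "(f ^^ k) ((g ^^ k) x) = x" if "\<And>y. f (g y) = y"
      for f g :: "real ^ 'n \<Rightarrow> real ^ 'n" and k
    proof (induction k)
      case (Suc k)
      have "(f ^^ Suc k) ((g ^^ Suc k) x) = (f ^^ k) (f (g ((g ^^ k) x)))"
        by (simp add: funpow_swap1)
      then show ?case using Suc by (simp only: that)
    qed simp
    ultimately show ?thesis by blast
  qed
  obtain K where K: "\<And>x. norm (?U x) \<le> K * norm x"
    using linear_bounded[of ?U] lin[OF matrix_vector_mul_linear] by blast
  \<comment> \<open>The lower bound 2 leaves room for the translation by \<open>u\<close> when the
    norms of the translates are estimated.\<close>
  define Q where "Q = max 2 K"
  have Q: "norm (?U x) \<le> Q * norm x" for x
    using K[of x] mult_right_mono[of K Q "norm x"] by (simp add: Q_def)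
  have intR: "integer_matrix (transpose R)" using assms(1) by (simp add: integer_matrix_def transpose_def)
  have intS: "integer_vector ((?S ^^ k) x)" if "integer_vector x" for k x
    by (induction k) (auto simp: that intro!: integer_matrix_mult_vector[OF intR] simp del: transpose_matrix_vector)
  have avg: "\<exists>ts. length ts = 2 ^ m \<and> (\<forall>t\<in>set ts. integer_vector t \<and> norm t \<le> Q ^ m - 1) \<and>
      (\<forall>x. (\<Sum>t\<leftarrow>ts. ?\<phi> (t + x)) \<le> (2 * \<rho>) ^ m)" for m
  proof (rule exponentially_small_averages[where g = ?g and U = ?U and V = ?V and u = u])
    show "?\<phi> x \<le> ?g (?V x) * ?\<phi> (?V x)" for x
      using \<phi>_le[of x M'] \<phi>_eq[of "(?T ^^ M') x"] by (simp add: M')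
    show "?g (x + t) = ?g x" if "integer_vector t" for x t
      using mask_periodic[of B t p x] assms(4) that by simp
    show "linear ?V" by (rule lin) (rule matrix_vector_mul_linear)
    show "integer_vector u" by (auto simp: u_def integer_vector_def axis_def)
  qed (use cmod_fourier_le_1[OF mu(1)] \<rho> VU intS Q in \<open>auto simp: u_def Q_def\<close>)
  have "\<exists>ts. length ts = 2 ^ m \<and> (\<forall>t\<in>set ts. norm t \<le> Q ^ m) \<and>
      (\<forall>x. (\<Sum>t\<leftarrow>ts. ?\<phi> (t + x)) \<le> (2 * \<rho>) ^ m)" for m
    using avg[of m] by (meson diff_le_eq less_eq_real_def order.trans le_add_same_cancel1 zero_le_one)
  from polynomial_growth_sequence[OF \<rho>(1,2) this]
  obtain s :: "nat \<Rightarrow> real ^ 'n" and \<kappa> where s: "0 < \<kappa>" "\<And>n. norm (s n) \<le> (2 * (real n + 2)) ^ \<kappa>"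
    "\<And>n. (\<Sum>i<n. ?\<phi> (s n - s i)) \<le> 1 / (4 * (real n + 1) * (real n + 2))" by blast
  note riesz = riesz_basic_spectrum_of_small_off_diagonal[OF mu s(3)]
  show ?thesis
    using riesz upper_beurling_dim_pos[OF riesz(1) s(1,2)] range_inj_infinite[OF riesz(1)] by blast
qed

end
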